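(* Let $\mu \in (0,1/4]$, $k, n \in \mathbb{N}$, $p$ prime and $v \in \mathbb{Z}_p^n$. Set $d = \frac{2}{\mu}\log\big(\rho_\mu(v)^{-1}\big)$, and suppose that $|v| \geq kd$ and $\rho_\mu(v) \geq \frac{2}{p}$. Then there exists $T \subseteq [n]$ with $|T| \leq d$ such that, setting $w = v_T$, we have $v_i \in N_\mu(w)$ for all but at most $kd$ values of $i \in [n]$, and \[ |N_\mu(w)| \leq \frac{256}{k^{1/5}} \cdot \frac{1}{\rho_\mu(v)}. \]
   Context: Notation: $[n]=\{1,\dots,n\}$, $\mathbb{Z}_p$ is the field of integers modulo $p$, and $\log$ is the natural logarithm. For a vector $v=(v_1,\dots,v_n)\in\mathbb{Z}_p^n$, $|v|$ denotes the number of non-zero entries of $v$ (for sets, $|\cdot|$ is cardinality). For $T\subseteq[n]$, $v_T := (v_i)_{i\in T}$. For a finite-dimensional vector $w=(w_1,\dots,w_m)$ over $\mathbb{Z}_p$ and $\mu\in[0,1]$, define the $\mathbb{Z}_p$-valued random variable $X_\mu(w) := \varepsilon_1 w_1+\cdots+\varepsilon_m w_m$, where the $\varepsilon_i\in\{-1,0,1\}$ are i.i.d. with $\mathbb{P}(\varepsilon_i=1)=\mathbb{P}(\varepsilon_i=-1)=\mu/2$ and $\mathbb{P}(\varepsilon_i = 0)=1-\mu$. Define $\rho_\mu(w) := \max_{x\in\mathbb{Z}_p}\mathbb{P}(X_\mu(w)=x)$, and the neighbourhood \[ N_\mu(w) := \{x\in\mathbb{Z}_p : \mathbb{P}(X_\mu(w)=x)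 > \tfrac12\,\mathbb{P}(X_\mu(w)=0)\}. \]
   Formalization: The vector v is assumed to be non-zero: for v = 0 one has ρ_μ(v) = 1, d = 0 and N_μ(w) = {0}, so the stated bound 1 ≤ 256/k^{1/5} fails when k > 2^40. *)

theory Defs
  imports
    "HOL-Probability.Probability"
    "Berlekamp_Zassenhaus.Finite_Field"
begin

text \<open>
  The field of integers modulo a prime \<open>p\<close> is the type \<open>'p mod_ring\<close> with
  \<open>'p :: prime_card\<close>, where \<open>p = CARD('p)\<close>.

  A finite vector over it is given by a finite index set \<open>I :: nat set\<close> together with an
  entry function \<open>w\<close>, of which only the values on \<open>I\<close> are ever used. The restriction of the
  vector \<open>({1..n}, v)\<close> to \<open>T \<subseteq> {1..n}\<close> is therefore the vector \<open>(T, v)\<close>.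
\<close>

definition weight :: "nat set \<Rightarrow> (nat \<Rightarrow> 'p::prime_card mod_ring) \<Rightarrow> nat" where
  "weight I w = card {i \<in> I. w i \<noteq> 0}"

definition lazy_sign :: "real \<Rightarrow> int pmf" where
  "lazy_sign \<mu> =
     bind_pmf (bernoulli_pmf \<mu>) (\<lambda>b. if b then pmf_of_set {-1, 1} else return_pmf 0)"

lemma pmf_lazy_sign:
  assumes "0 \<le> \<mu>" "\<mu> \<le> 1"
  shows "pmf (lazy_sign \<mu>) 1 = \<mu> / 2"
    and "pmf (lazy_sign \<mu>) (-1) = \<mu> / 2"
    and "pmf (lazy_sign \<mu>) 0 = 1 - \<mu>"
  using assms by (simp_all add: lazy_sign_def pmf_bind pmf_of_set)

text \<open>
  \<open>walk_pmf \<mu> I w\<close> is the distribution of \<open>\<Sum>i\<in>I. \<epsilon>\<^sub>i w\<^sub>i\<close>, where the \<open>\<epsilon>\<^sub>i\<close> are independent with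
  distribution \<open>lazy_sign \<mu>\<close>; the argument \<open>0\<close> of \<open>Pi_pmf\<close> is only the default value
  outside \<open>I\<close>.
\<close>

definition walk_pmf ::
  "real \<Rightarrow> nat set \<Rightarrow> (nat \<Rightarrow> 'p::prime_card mod_ring) \<Rightarrow> 'p mod_ring pmf" where
  "walk_pmf \<mu> I w =
     map_pmf (\<lambda>\<epsilon>. \<Sum>i\<in>I. of_int (\<epsilon> i) * w i) (Pi_pmf I 0 (\<lambda>_. lazy_sign \<mu>))"

definition rho :: "real \<Rightarrow> nat set \<Rightarrow> (nat \<Rightarrow> 'p::prime_card mod_ring) \<Rightarrow> real" where
  "rho \<mu> I w = (MAX x. pmf (walk_pmf \<mu> I w) x)"

definition nbhd ::
  "real \<Rightarrow> nat set \<Rightarrow> (nat \<Rightarrow> 'p::prime_card mod_ring) \<Rightarrow> 'p mod_ring set" where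
  "nbhd \<mu> I w = {x. pmf (walk_pmf \<mu> I w) x > 1 / 2 * pmf (walk_pmf \<mu> I w) 0}"

end

theory Submission
  imports Defs
begin

text \<open>
  Write \<open>f\<^sub>I\<close> for the transform of the walk on the index set \<open>I\<close>. As \<open>\<mu> \<le> 1 / 4\<close>, its factors
  lie in \<open>[0, 1]\<close>, so the walk is most likely to be at \<open>0\<close>, and \<open>\<rho>\<close> is the average of \<open>f\<^sub>I\<close> over
  the field. Hence \<open>\<rho>\<close> only grows when indices are dropped.

  Enlarge \<open>T\<close> by an index whose entry lies outside the neighbourhood of \<open>v\<^sub>T\<close>: the
  probability of being at \<open>0\<close> falls by the factor \<open>1 - \<mu> / 2\<close>. As this probability is at least
  \<open>\<rho>(v)\<close>, such a process stops with fewer than \<open>d\<close> indices (\<open>greedy_block\<close>, \<open>block_size_less\<close>).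
  Repeating it on the remaining indices gives \<open>k\<close> disjoint blocks with fewer than \<open>k d\<close> indices
  together, and every entry outside all blocks lies in the neighbourhood of each block. Because \<open>v\<close>
  has at least \<open>k d\<close> nonzero entries, one of those outside entries is nonzero.

  The theorem holds for one of the blocks. By the inequality of the arithmetic and geometric
  means, some block has \<open>\<Sum> f ^ k \<ge> p \<rho>(v)\<close>, where the sum is over the field of order \<open>p\<close>
  (\<open>block_with_large_power_mean\<close>). In the other direction, a Halasz-type argument
  (\<open>power_mean_bound\<close>) shows that raising to the power \<open>k\<close> gains a factor \<open>O(k powr (- 1 / 5))\<close>:
  \<open>- log f\<close> is comparable to the square of a subadditive function, so the level set of height
  \<open>1 / m\<^sup>2\<close> has an \<open>m\<close>-fold sumset inside the level set of constant height, and by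
  Cauchy--Davenport (\<open>cauchy_davenport\<close>) it is about \<open>m\<close> times smaller. Outside the small level
  set \<open>f ^ k\<close> is negligible. Two points need the hypotheses: the sumset must not fill the field,
  which holds because a nonzero element of the neighbourhood forces \<open>\<rho> \<le> 2 / 3\<close> for the block;
  and the point \<open>0\<close> of the level set, which does not spread, contributes at most half of
  \<open>\<Sum> f ^ k\<close> because \<open>p \<rho>(v) \<ge> 2\<close>. Since the neighbourhood of a block has at most
  \<open>2 / \<rho>\<close> elements, \<open>\<rho>\<close> being that of the block, the two bounds together give the claim.
\<close>

section \<open>Sumsets in the integers modulo a prime\<close>

lemma shift_invariant_imp_UNIV:
  fixes A :: "'p::prime_card mod_ring set"
  assumes "a \<in> A" and c: "c \<noteq> 0" and closed: "\<And>x. x \<in> A \<Longrightarrow> x + c \<in> A"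
  shows "A = UNIV"
proof -
  have multiple: "a + of_nat j * c \<in> A" for j :: nat
  proof (induction j)
    case (Suc j)
    show ?case using closed[OF Suc.IH] by (simp add: algebra_simps)
  qed (use assms in simp)
  have "x \<in> A" for x
  proof -
    obtain j where "(x - a) / c = of_nat j" using surj_of_nat_mod_ring by blast
    then have "x - a = of_nat j * c" using c by (simp add: field_simps)
    then have "x = a + of_nat j * c" by (simp add: algebra_simps)
    then show ?thesis using multiple by simp
  qed
  then show ?thesis by auto
qed

text \<open>
  The Cauchy--Davenport inequality, by the Dyson transform: since \<open>A\<close> is not invariant under the
  difference of two elements of \<open>B\<close>, some translate of \<open>B\<close> meets \<open>A\<close> without lying
  in it. Moving the part outside \<open>A\<close> from \<open>B\<close> to \<open>A\<close> shrinks \<open>B\<close>, keeps \<open>|A| + |B|\<close>, and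
  creates no sum outside \<open>S\<close>.
\<close>

lemma cauchy_davenport:
  fixes A B S :: "'p::prime_card mod_ring set"
  assumes "A \<noteq> {}" and "B \<noteq> {}" and "\<And>a b. a \<in> A \<Longrightarrow> b \<in> B \<Longrightarrow> a + b \<in> S"
  shows "min (CARD('p)) (card A + card B - 1) \<le> card S"
  using assms
proof (induction "card B" arbitrary: A B rule: less_induct)
  case (less B A)
  obtain a0 where a0: "a0 \<in> A" using less.prems by auto
  obtain b0 where b0: "b0 \<in> B" using less.prems by auto
  show ?case
  proof (cases "A = UNIV")
    case True
    have "x \<in> S" for x
      using less.prems(3)[of "x - b0" b0] True b0 by simp
    then have "S = UNIV" by auto
    then show ?thesis by simp
  next
    case not_all: False
    show ?thesis
    proof (cases "B = {b0}")
      case True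
      have "(\<lambda>a. a + b0) ` A \<subseteq> S" using less.prems(3) b0 by auto
      then have "card ((\<lambda>a. a + b0) ` A) \<le> card S" by (intro card_mono) auto
      then show ?thesis using True by (simp add: card_image inj_on_def)
    next
      case False
      then obtain b1 where b1: "b1 \<in> B" "b1 \<noteq> b0" using b0 by blast
      have "\<exists>a\<in>A. a + (b1 - b0) \<notin> A"
        using shift_invariant_imp_UNIV[OF a0, of "b1 - b0"] b1 not_all by auto
      then obtain a where a: "a \<in> A" "a + (b1 - b0) \<notin> A" by blast
      \<comment> \<open>The translate by \<open>e\<close> carries \<open>b0\<close> into \<open>A\<close> and \<open>b1\<close> outside \<open>A\<close>.\<close>
      define e where "e = a - b0"
      define A' where "A' = A \<union> (\<lambda>b. b + e) ` B"
      define B' where "B' = {b \<in> B. b + e \<in> A}"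
      have "b0 \<in> B'" "b1 \<notin> B'" using b0 a by (auto simp: B'_def e_def algebra_simps)
      then have "B' \<subset> B" "B' \<noteq> {}" using b1 by (auto simp: B'_def)
      moreover from this have "card B' < card B" by (intro psubset_card_mono) auto
      moreover have "A' \<noteq> {}" using a0 by (auto simp: A'_def)
      moreover have "x + y \<in> S" if xy: "x \<in> A'" "y \<in> B'" for x y
      proof (cases "x \<in> A")
        case True
        then show ?thesis using xy less.prems(3) by (auto simp: B'_def)
      next
        case False
        then obtain b where "b \<in> B" "x = b + e" using xy by (auto simp: A'_def)
        moreover have "y + e \<in> A" using xy by (auto simp: B'_def)
        ultimately have "(y + e) + b \<in> S" using less.prems(3) by blast
        then show ?thesis using \<open>x = b + e\<close> by (simp add: algebra_simps)
      qed
      ultimately have IH: "min (CARD('p)) (card A' + card B' - 1) \<le> card S"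
        by (intro less.hyps) auto
      have "card A' + card (A \<inter> (\<lambda>b. b + e) ` B) = card A + card ((\<lambda>b. b + e) ` B)"
        unfolding A'_def by (rule card_Un_Int[symmetric]) auto
      moreover have "A \<inter> (\<lambda>b. b + e) ` B = (\<lambda>b. b + e) ` B'"
        by (auto simp: B'_def)
      ultimately have "card A' + card B' = card A + card B"
        by (simp add: card_image inj_on_def)
      then show ?thesis using IH by simp
    qed
  qed
qed

text \<open>
  The \<open>m\<close>-fold sumset of the sublevel set at height \<open>r\<close> lies in the one at height \<open>m r\<close>. The
  subtracted \<open>1\<close> is the element \<open>0\<close>, which does not spread under addition.
\<close>

lemma card_sublevel_dilate:
  fixes q :: "'p::prime_card mod_ring \<Rightarrow> real"
  assumes q0: "q 0 = 0" and subadd: "\<And>x y. q (x + y) \<le> q x + q y" and "0 \<le> r"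
  shows "min (CARD('p)) (m * (card {x. q x \<le> r} - 1) + 1) \<le> card {x. q x \<le> real m * r}"
proof (induction m)
  case 0
  have "0 \<in> {x. q x \<le> real 0 * r}" using q0 by simp
  then have "card {x. q x \<le> real 0 * r} > 0" by (auto simp: card_gt_0_iff)
  then show ?case by simp
next
  case (Suc m)
  let ?A = "{x. q x \<le> real m * r}" and ?B = "{x. q x \<le> r}"
  have zero: "0 \<in> ?A" "0 \<in> ?B" using q0 \<open>0 \<le> r\<close> by auto
  have "min (CARD('p)) (card ?A + card ?B - 1) \<le> card {x. q x \<le> real (Suc m) * r}"
  proof (rule cauchy_davenport)
    fix a b assume "a \<in> ?A" "b \<in> ?B"
    then have "q (a + b) \<le> real m * r + r" using subadd[of a b] by simp
    then show "a + b \<in> {x. q x \<le> real (Suc m) * r}" by (simp add: algebra_simps)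
  qed (use zero in blast)+
  moreover have "card ?B \<ge> 1" using zero by (auto simp: Suc_le_eq card_gt_0_iff)
  ultimately show ?case using Suc.IH by (auto simp: min_def split: if_splits)
qed

section \<open>The cosine characters\<close>

text \<open>
  All distributions here are symmetric, so the real parts of the additive characters carry the
  whole Fourier transform. The absolute value makes the sine of the half angle independent of the
  representative modulo \<open>p\<close>, and subadditive.
\<close>

definition cos_char :: "'p::prime_card mod_ring \<Rightarrow> real" where
  "cos_char x = cos (2 * pi * to_int_mod_ring x / CARD('p))"

definition sin_char :: "'p::prime_card mod_ring \<Rightarrow> real" where
  "sin_char x = \<bar>sin (pi * to_int_mod_ring x / CARD('p))\<bar>"

lemma cos_char_of_int:
  "cos_char (of_int j :: 'p::prime_card mod_ring) = cos (2 * pi * j / CARD('p))"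
  and sin_char_of_int:
  "sin_char (of_int j :: 'p mod_ring) = \<bar>sin (pi * j / CARD('p))\<bar>"
proof -
  let ?p = "int CARD('p)"
  have p: "?p > 0" by simp
  have rep: "to_int_mod_ring (of_int j :: 'p mod_ring) = j mod ?p"
    by (simp add: of_int_of_int_mod_ring of_int_mod_ring.rep_eq to_int_mod_ring.rep_eq)
  have "real_of_int (j mod ?p) = j - ?p * (j div ?p)"
    by (metis minus_mult_div_eq_mod of_int_diff of_int_mult)
  then have eq: "real_of_int (j mod ?p) / CARD('p) = j / CARD('p) - (j div ?p)"
    by (simp add: field_simps)
  have "2 * pi * (j mod ?p) / CARD('p) = 2 * pi * j / CARD('p) - 2 * pi * (j div ?p)"
    using arg_cong[OF eq, of "\<lambda>t. 2 * pi * t"] by (simp add: right_diff_distrib)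
  then have "cos (2 * pi * (j mod ?p) / CARD('p)) = cos (2 * pi * j / CARD('p) - 2 * pi * (j div ?p))"
    by (rule arg_cong)
  also have "\<dots> = cos (2 * pi * j / CARD('p))"
    by (simp add: cos_diff)
  finally show "cos_char (of_int j :: 'p mod_ring) = cos (2 * pi * j / CARD('p))"
    by (simp add: cos_char_def rep)
  have "pi * (j mod ?p) / CARD('p) = pi * j / CARD('p) - pi * (j div ?p)"
    using arg_cong[OF eq, of "\<lambda>t. pi * t"] by (simp add: right_diff_distrib)
  then have "\<bar>sin (pi * (j mod ?p) / CARD('p))\<bar> = \<bar>sin (pi * j / CARD('p) - pi * (j div ?p))\<bar>"
    by (rule arg_cong)
  also have "\<dots> = \<bar>sin (pi * j / CARD('p))\<bar>"
    by (simp add: sin_diff abs_mult)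
  finally show "sin_char (of_int j :: 'p mod_ring) = \<bar>sin (pi * j / CARD('p))\<bar>"
    by (simp add: sin_char_def rep)
qed

lemma mod_ring_of_int_cases:
  obtains j :: int where "(x :: 'p::prime_card mod_ring) = of_int j"
  by (metis of_int_mod_ring_to_int_mod_ring of_int_of_int_mod_ring)

lemma cos_char_add_diff:
  "cos_char (x + y) + cos_char (x - y) = 2 * cos_char x * cos_char (y :: 'p::prime_card mod_ring)"
proof -
  obtain a where a: "x = of_int a" by (rule mod_ring_of_int_cases)
  obtain b where b: "y = of_int b" by (rule mod_ring_of_int_cases)
  have "cos_char (x + y) = cos (2 * pi * a / CARD('p) + 2 * pi * b / CARD('p))"
    unfolding a b of_int_add[symmetric] cos_char_of_int by (simp add: distrib_left add_divide_distrib)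
  moreover have "cos_char (x - y) = cos (2 * pi * a / CARD('p) - 2 * pi * b / CARD('p))"
    unfolding a b of_int_diff[symmetric] cos_char_of_int by (simp add: right_diff_distrib diff_divide_distrib)
  ultimately show ?thesis
    by (simp add: a b cos_char_of_int cos_add cos_diff)
qed

lemma sin_char_add_le:
  "sin_char (x + y) \<le> sin_char x + sin_char (y :: 'p::prime_card mod_ring)"
proof -
  obtain a where a: "x = of_int a" by (rule mod_ring_of_int_cases)
  obtain b where b: "y = of_int b" by (rule mod_ring_of_int_cases)
  let ?s = "pi * a / CARD('p)" and ?t = "pi * b / CARD('p)"
  have "sin_char (x + y) = \<bar>sin (?s + ?t)\<bar>"
    unfolding a b of_int_add[symmetric] sin_char_of_int by (simp add: distrib_left add_divide_distrib)
  also have "\<dots> \<le> \<bar>sin ?s\<bar> * \<bar>cos ?t\<bar> + \<bar>cos ?s\<bar> * \<bar>sin ?t\<bar>"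
    unfolding sin_add abs_mult[symmetric] by (rule abs_triangle_ineq)
  also have "\<dots> \<le> \<bar>sin ?s\<bar> * 1 + 1 * \<bar>sin ?t\<bar>"
    by (intro add_mono mult_mono) auto
  finally show ?thesis by (simp add: a b sin_char_of_int)
qed

lemma cos_char_0 [simp]: "cos_char 0 = 1" and sin_char_0 [simp]: "sin_char 0 = 0"
  using cos_char_of_int[of 0] sin_char_of_int[of 0] by simp_all

lemma cos_char_minus [simp]: "cos_char (- x) = cos_char x"
  using cos_char_add_diff[of 0 x] by simp

lemma cos_char_le_1 [simp]: "cos_char x \<le> 1"
  by (simp add: cos_char_def)

lemma cos_char_conv_sin_char: "cos_char x = 1 - 2 * (sin_char x)\<^sup>2"
  using cos_double_sin[of "pi * to_int_mod_ring x / CARD('a)"]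
  by (simp add: cos_char_def sin_char_def mult.assoc)

text \<open>
  Orthogonality without roots of unity: by the addition formula, the sum \<open>Z\<close> of all values
  satisfies \<open>2 Z = 2 cos(2 \<pi> / p) Z\<close>, so it vanishes.
\<close>

lemma sum_cos_char:
  "(\<Sum>y\<in>UNIV. cos_char (x * y)) = (if x = 0 then real CARD('p) else 0)"
  for x :: "'p::prime_card mod_ring"
proof (cases "x = 0")
  case True
  then show ?thesis by simp
next
  case False
  define Z where "Z = (\<Sum>y\<in>UNIV. cos_char (y :: 'p mod_ring))"
  have reindex: "bij (\<lambda>y. x * y)"
  proof (rule o_bij[of "\<lambda>y. y / x"])
  qed (use False in \<open>auto simp: fun_eq_iff\<close>)
  have shift: "(\<Sum>y\<in>UNIV. cos_char (y + c)) = Z" for c :: "'p mod_ring"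
    unfolding Z_def
    by (rule sum.reindex_bij_betw[of "\<lambda>y. y + c" UNIV UNIV]) 
       (auto intro!: o_bij[of "\<lambda>y. y - c"] simp: fun_eq_iff)
  have "2 * cos_char (1 :: 'p mod_ring) * Z
      = (\<Sum>y\<in>UNIV. cos_char (y + 1) + cos_char (y - (1 :: 'p mod_ring)))"
    unfolding cos_char_add_diff Z_def by (simp add: sum_distrib_left sum_distrib_right mult_ac)
  also have "\<dots> = 2 * Z"
    using shift[of 1] shift[of "-1"] by (simp add: sum.distrib)
  finally have "(1 - cos_char (1 :: 'p mod_ring)) * Z = 0" by (simp add: algebra_simps)
  moreover have "sin_char (1 :: 'p mod_ring) \<noteq> 0"
  proof -
    have "(1::real) < CARD('p)" using prime_card[where ?'a = 'p] prime_gt_1_nat by auto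
    then have "sin (pi / CARD('p)) > 0"
      by (intro sin_gt_zero) (auto simp: field_simps)
    then show ?thesis using sin_char_of_int[of 1, where ?'p = 'p] by simp
  qed
  ultimately have "Z = 0" by (auto simp: cos_char_conv_sin_char)
  moreover have "(\<Sum>y\<in>UNIV. cos_char (x * y)) = Z"
    unfolding Z_def by (rule sum.reindex_bij_betw[OF reindex])
  ultimately show ?thesis using False by simp
qed

section \<open>Fourier analysis of the walk\<close>

lemma walk_pmf_empty [simp]: "walk_pmf \<mu> {} v = return_pmf 0"
  by (simp add: walk_pmf_def)

lemma pmf_walk_insert:
  fixes v :: "nat \<Rightarrow> 'p::prime_card mod_ring"
  assumes "0 \<le> \<mu>" "\<mu> \<le> 1" "finite I" "i \<notin> I"
  shows "pmf (walk_pmf \<mu> (insert i I) v) x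
       = (1 - \<mu>) * pmf (walk_pmf \<mu> I v) x
         + \<mu> / 2 * (pmf (walk_pmf \<mu> I v) (x - v i) + pmf (walk_pmf \<mu> I v) (x + v i))"
proof -
  let ?P = "Pi_pmf I 0 (\<lambda>_. lazy_sign \<mu>)"
  have "walk_pmf \<mu> (insert i I) v
      = map_pmf (\<lambda>(e, f). \<Sum>j\<in>insert i I. of_int ((f(i := e)) j) * v j) (pair_pmf (lazy_sign \<mu>) ?P)"
    using assms by (simp add: walk_pmf_def Pi_pmf_insert map_pmf_comp o_def case_prod_unfold del: fun_upd_apply)
  also have "\<dots> = map_pmf (\<lambda>(e, f). of_int e * v i + (\<Sum>j\<in>I. of_int (f j) * v j)) (pair_pmf (lazy_sign \<mu>) ?P)"
  proof (rule map_pmf_cong[OF refl], clarify)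
    fix e and f :: "nat \<Rightarrow> int"
    have "(\<Sum>j\<in>I. of_int ((f(i := e)) j) * v j) = (\<Sum>j\<in>I. of_int (f j) * v j)"
      using assms by (intro sum.cong) auto
    then show "(\<Sum>j\<in>insert i I. of_int ((f(i := e)) j) * v j)
        = of_int e * v i + (\<Sum>j\<in>I. of_int (f j) * v j)"
      using assms by simp
  qed
  also have "\<dots> = bind_pmf (lazy_sign \<mu>) (\<lambda>e. map_pmf (\<lambda>s. of_int e * v i + s) (walk_pmf \<mu> I v))"
    by (simp add: pair_pmf_def walk_pmf_def map_bind_pmf map_pmf_comp o_def flip: map_pmf_def)
  finally have walk: "walk_pmf \<mu> (insert i I) v
      = bind_pmf (lazy_sign \<mu>) (\<lambda>e. map_pmf (\<lambda>s. of_int e * v i + s) (walk_pmf \<mu> I v))" .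
  have shift: "pmf (map_pmf (\<lambda>s. c + s) M) x = pmf M (x - c)" for c and M :: "'p mod_ring pmf"
    using pmf_map_inj'[of "\<lambda>s. c + s" M "x - c"] by (simp add: inj_def)
  show ?thesis
    unfolding walk lazy_sign_def bind_assoc_pmf pmf_bind
    using assms
    by (simp add: if_distrib[of "\<lambda>M. bind_pmf M _"] if_distrib[of "\<lambda>M. pmf M _"] bind_return_pmf
        pmf_bind integral_pmf_of_set shift cong: if_cong)
qed

definition walk_transform ::
  "real \<Rightarrow> nat set \<Rightarrow> (nat \<Rightarrow> 'p::prime_card mod_ring) \<Rightarrow> 'p mod_ring \<Rightarrow> real" where
  "walk_transform \<mu> I v y = (\<Prod>i\<in>I. 1 - \<mu> + \<mu> * cos_char (y * v i))"

text \<open>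
  One step of the walk averages over the shifts by \<open>0\<close> and \<open>\<plusminus> v i\<close>, and the addition formula for the
  cosine turns this average into one factor of the transform.
\<close>

lemma walk_fourier_inversion:
  fixes v :: "nat \<Rightarrow> 'p::prime_card mod_ring"
  assumes "0 \<le> \<mu>" "\<mu> \<le> 1" "finite I"
  shows "real CARD('p) * pmf (walk_pmf \<mu> I v) x
       = (\<Sum>y\<in>UNIV. walk_transform \<mu> I v y * cos_char (x * y))"
  using \<open>finite I\<close>
proof (induction I arbitrary: x)
  case empty
  show ?case by (simp add: walk_transform_def sum_cos_char pmf_return)
next
  case (insert i I)
  have "real CARD('p) * pmf (walk_pmf \<mu> (insert i I) v) x
      = (1 - \<mu>) * (real CARD('p) * pmf (walk_pmf \<mu> I v) x)
        + \<mu> / 2 * (real CARD('p) * pmf (walk_pmf \<mu> I v) (x - v i)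
                  + real CARD('p) * pmf (walk_pmf \<mu> I v) (x + v i))"
    using insert assms by (subst pmf_walk_insert) (auto simp: algebra_simps)
  also have "\<dots> = (\<Sum>y\<in>UNIV. walk_transform \<mu> I v y * ((1 - \<mu>) * cos_char (x * y)
        + \<mu> / 2 * (cos_char (x * y - y * v i) + cos_char (x * y + y * v i))))"
    unfolding insert.IH sum_distrib_left sum.distrib[symmetric]
    by (intro sum.cong) (simp_all add: algebra_simps)
  also have "\<dots> = (\<Sum>y\<in>UNIV. walk_transform \<mu> (insert i I) v y * cos_char (x * y))"
  proof (intro sum.cong refl)
    fix y
    have product: "cos_char (x * y - y * v i) + cos_char (x * y + y * v i)
        = 2 * cos_char (x * y) * cos_char (y * v i)"
      using cos_char_add_diff[of "x * y" "y * v i"] by simp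
    have split: "walk_transform \<mu> (insert i I) v y
        = (1 - \<mu> + \<mu> * cos_char (y * v i)) * walk_transform \<mu> I v y"
      using insert by (simp add: walk_transform_def)
    show "walk_transform \<mu> I v y * ((1 - \<mu>) * cos_char (x * y)
        + \<mu> / 2 * (cos_char (x * y - y * v i) + cos_char (x * y + y * v i)))
        = walk_transform \<mu> (insert i I) v y * cos_char (x * y)"
      unfolding product split by (simp add: algebra_simps)
  qed
  finally show ?case .
qed

lemma walk_factor_bounds:
  assumes "0 \<le> \<mu>" "\<mu> \<le> 1 / 4"
  shows "0 \<le> 1 - \<mu> + \<mu> * cos_char x" "1 - \<mu> + \<mu> * cos_char x \<le> 1"
proof -
  have "- \<mu> \<le> \<mu> * cos_char x"
    using mult_left_mono[of "-1" "cos_char x" \<mu>] assms by (simp add: cos_char_def)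
  then show "0 \<le> 1 - \<mu> + \<mu> * cos_char x" using assms by simp
  show "1 - \<mu> + \<mu> * cos_char x \<le> 1"
    using mult_left_mono[of "cos_char x" 1 \<mu>] assms by simp
qed

lemma walk_transform_nonneg:
  assumes "0 \<le> \<mu>" "\<mu> \<le> 1 / 4"
  shows "0 \<le> walk_transform \<mu> I v y"
  unfolding walk_transform_def using assms walk_factor_bounds by (intro prod_nonneg) auto

lemma walk_transform_le_1:
  assumes "0 \<le> \<mu>" "\<mu> \<le> 1 / 4"
  shows "walk_transform \<mu> I v y \<le> 1"
  unfolding walk_transform_def using assms walk_factor_bounds by (intro prod_le_1) auto

lemma walk_transform_antimono:
  assumes "0 \<le> \<mu>" "\<mu> \<le> 1 / 4" "finite I" "J \<subseteq> I"
  shows "walk_transform \<mu> I v y \<le> walk_transform \<mu> J v y"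
proof -
  have "finite J" "finite (I - J)" "I = J \<union> (I - J)" using assms finite_subset by auto
  then have "walk_transform \<mu> I v y = walk_transform \<mu> J v y * walk_transform \<mu> (I - J) v y"
    unfolding walk_transform_def by (metis Diff_disjoint prod.union_disjoint)
  also have "\<dots> \<le> walk_transform \<mu> J v y"
    using assms walk_transform_nonneg walk_transform_le_1 by (intro mult_right_le_one_le) auto
  finally show ?thesis .
qed

lemma pmf_walk_0:
  fixes v :: "nat \<Rightarrow> 'p::prime_card mod_ring"
  assumes "0 \<le> \<mu>" "\<mu> \<le> 1 / 4" "finite I"
  shows "real CARD('p) * pmf (walk_pmf \<mu> I v) 0 = (\<Sum>y\<in>UNIV. walk_transform \<mu> I v y)"
  using assms by (subst walk_fourier_inversion) auto

lemma pmf_walk_le_0: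
  fixes v :: "nat \<Rightarrow> 'p::prime_card mod_ring"
  assumes "0 \<le> \<mu>" "\<mu> \<le> 1 / 4" "finite I"
  shows "pmf (walk_pmf \<mu> I v) x \<le> pmf (walk_pmf \<mu> I v) 0"
proof -
  have "real CARD('p) * pmf (walk_pmf \<mu> I v) x
      = (\<Sum>y\<in>UNIV. walk_transform \<mu> I v y * cos_char (x * y))"
    using assms by (intro walk_fourier_inversion) auto
  also have "\<dots> \<le> (\<Sum>y\<in>UNIV. walk_transform \<mu> I v y)"
    using walk_transform_nonneg[OF assms(1,2)] by (intro sum_mono mult_left_le) auto
  finally have "real CARD('p) * pmf (walk_pmf \<mu> I v) x \<le> real CARD('p) * pmf (walk_pmf \<mu> I v) 0"
    unfolding pmf_walk_0[OF assms] .
  then show ?thesis by simp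
qed

lemma pmf_walk_minus:
  fixes v :: "nat \<Rightarrow> 'p::prime_card mod_ring"
  assumes "0 \<le> \<mu>" "\<mu> \<le> 1" "finite I"
  shows "pmf (walk_pmf \<mu> I v) (- x) = pmf (walk_pmf \<mu> I v) x"
proof -
  have "real CARD('p) * pmf (walk_pmf \<mu> I v) (- x) = real CARD('p) * pmf (walk_pmf \<mu> I v) x"
    unfolding walk_fourier_inversion[OF assms] by (simp only: mult_minus_left cos_char_minus)
  then show ?thesis by simp
qed

lemma rho_eq_pmf_0:
  assumes "0 \<le> \<mu>" "\<mu> \<le> 1 / 4" "finite I"
  shows "rho \<mu> I v = pmf (walk_pmf \<mu> I v) 0"
  unfolding rho_def
proof (rule Max_eqI)
  show "y \<le> pmf (walk_pmf \<mu> I v) 0" if "y \<in> range (pmf (walk_pmf \<mu> I v))" for y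
    using that pmf_walk_le_0[OF assms] by blast
qed simp_all

lemma pmf_walk_0_antimono:
  fixes v :: "nat \<Rightarrow> 'p::prime_card mod_ring"
  assumes "0 \<le> \<mu>" "\<mu> \<le> 1 / 4" "finite I" "J \<subseteq> I"
  shows "pmf (walk_pmf \<mu> I v) 0 \<le> pmf (walk_pmf \<mu> J v) 0"
proof -
  have "finite J" using assms finite_subset by auto
  then have "real CARD('p) * pmf (walk_pmf \<mu> I v) 0 \<le> real CARD('p) * pmf (walk_pmf \<mu> J v) 0"
    unfolding pmf_walk_0[OF assms(1-3)] pmf_walk_0[OF assms(1,2) \<open>finite J\<close>]
    by (intro sum_mono walk_transform_antimono assms)
  then show ?thesis by simp
qed

text \<open>
  Each element of the neighbourhood has more than half the probability of \<open>0\<close>, and all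
  probabilities add up to \<open>1\<close>; this gives the next two bounds.
\<close>

lemma card_nbhd_le:
  fixes v :: "nat \<Rightarrow> 'p::prime_card mod_ring"
  shows "real (card (nbhd \<mu> I v)) * pmf (walk_pmf \<mu> I v) 0 \<le> 2"
proof -
  let ?P = "pmf (walk_pmf \<mu> I v)"
  have "real (card (nbhd \<mu> I v)) * (1 / 2 * ?P 0) \<le> (\<Sum>x\<in>nbhd \<mu> I v. ?P x)"
    by (rule sum_bounded_below) (auto simp: nbhd_def)
  also have "\<dots> \<le> (\<Sum>x\<in>UNIV. ?P x)" by (intro sum_mono2) auto
  also have "\<dots> = 1" by (rule sum_pmf_eq_1) auto
  finally show ?thesis by simp
qed

lemma pmf_walk_0_le_of_nbhd:
  fixes v :: "nat \<Rightarrow> 'p::prime_card mod_ring"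
  assumes "x \<in> nbhd \<mu> I v" "x \<noteq> 0"
  shows "pmf (walk_pmf \<mu> I v) 0 \<le> 2 / 3"
proof -
  let ?P = "pmf (walk_pmf \<mu> I v)"
  have "?P 0 + ?P x = (\<Sum>x\<in>{0, x}. ?P x)" using assms by simp
  also have "\<dots> \<le> (\<Sum>x\<in>UNIV. ?P x)" by (intro sum_mono2) auto
  also have "\<dots> = 1" by (rule sum_pmf_eq_1) auto
  finally show ?thesis using assms by (simp add: nbhd_def)
qed

section \<open>Level sets of the transform\<close>

text \<open>
  The square of \<open>walk_norm\<close> is the sum of the deficits \<open>1 - (factor)\<close> over the factors of the
  transform, so it plays the role of \<open>- log f\<close>. Its square root is used because it is an
  \<open>\<ell>\<^sup>2\<close> norm and therefore subadditive.
\<close>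

definition walk_norm ::
  "real \<Rightarrow> nat set \<Rightarrow> (nat \<Rightarrow> 'p::prime_card mod_ring) \<Rightarrow> 'p mod_ring \<Rightarrow> real" where
  "walk_norm \<mu> I v y = L2_set (\<lambda>i. sqrt (2 * \<mu>) * sin_char (y * v i)) I"

lemma walk_norm_0 [simp]: "walk_norm \<mu> I v 0 = 0"
  by (simp add: walk_norm_def L2_set_def)

lemma walk_norm_add_le:
  assumes "0 \<le> \<mu>"
  shows "walk_norm \<mu> I v (x + y) \<le> walk_norm \<mu> I v x + walk_norm \<mu> I v y"
proof -
  have "walk_norm \<mu> I v (x + y)
      \<le> L2_set (\<lambda>i. sqrt (2 * \<mu>) * sin_char (x * v i) + sqrt (2 * \<mu>) * sin_char (y * v i)) I"
    unfolding walk_norm_def distrib_right distrib_left[symmetric]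
    using assms sin_char_add_le by (intro L2_set_mono mult_left_mono) (auto simp: sin_char_def)
  also have "\<dots> \<le> walk_norm \<mu> I v x + walk_norm \<mu> I v y"
    unfolding walk_norm_def by (rule L2_set_triangle_ineq)
  finally show ?thesis .
qed

lemma walk_norm_power2:
  assumes "0 \<le> \<mu>"
  shows "(walk_norm \<mu> I v y)\<^sup>2 = (\<Sum>i\<in>I. 2 * \<mu> * (sin_char (y * v i))\<^sup>2)"
  using assms by (simp add: walk_norm_def L2_set_def sum_nonneg power_mult_distrib)

lemma walk_transform_conv_sin:
  "walk_transform \<mu> I v y = (\<Prod>i\<in>I. 1 - 2 * \<mu> * (sin_char (y * v i))\<^sup>2)"
  unfolding walk_transform_def cos_char_conv_sin_char by (intro prod.cong) (auto simp: algebra_simps)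

lemma walk_transform_ge:
  assumes "0 \<le> \<mu>" "\<mu> \<le> 1 / 4"
  shows "1 - (walk_norm \<mu> I v y)\<^sup>2 \<le> walk_transform \<mu> I v y"
  unfolding walk_norm_power2[OF assms(1)] walk_transform_conv_sin
proof (rule Weierstrass_prod_ineq)
  fix i
  show "2 * \<mu> * (sin_char (y * v i))\<^sup>2 \<in> {0..1}"
    using walk_factor_bounds[OF assms, of "y * v i"] assms
    by (simp add: cos_char_conv_sin_char algebra_simps)
qed

lemma walk_transform_le_exp:
  assumes "0 \<le> \<mu>" "\<mu> \<le> 1 / 4" "finite I"
  shows "walk_transform \<mu> I v y \<le> exp (- (walk_norm \<mu> I v y)\<^sup>2)"
proof -
  have "walk_transform \<mu> I v y \<le> (\<Prod>i\<in>I. exp (- (2 * \<mu> * (sin_char (y * v i))\<^sup>2)))"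
    unfolding walk_transform_conv_sin
  proof (rule prod_mono, intro conjI)
    fix i
    show "0 \<le> 1 - 2 * \<mu> * (sin_char (y * v i))\<^sup>2"
      using walk_factor_bounds[OF assms(1,2), of "y * v i"]
      by (simp add: cos_char_conv_sin_char algebra_simps)
    show "1 - 2 * \<mu> * (sin_char (y * v i))\<^sup>2 \<le> exp (- (2 * \<mu> * (sin_char (y * v i))\<^sup>2))"
      using exp_ge_add_one_self[of "- (2 * \<mu> * (sin_char (y * v i))\<^sup>2)"] by simp
  qed
  also have "\<dots> = exp (- (walk_norm \<mu> I v y)\<^sup>2)"
    using assms by (simp add: walk_norm_power2 exp_sum flip: sum_negf)
  finally show ?thesis .
qed

text \<open>
  Where \<open>walk_norm\<close> is at most \<open>1 / 2\<close>, the transform is at least \<open>3 / 4\<close>. If this were the whole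
  field, the average of the transform would exceed \<open>2 / 3\<close>. So the \<open>m\<close>-fold sumset of the smaller
  level set does not fill the field, and its size is controlled by \<open>\<Sum> f\<close>.
\<close>

lemma card_small_norm_le:
  fixes v :: "nat \<Rightarrow> 'p::prime_card mod_ring"
  assumes \<mu>: "0 \<le> \<mu>" "\<mu> \<le> 1 / 4" and "finite I" and "m \<ge> 1"
    and spread: "pmf (walk_pmf \<mu> I v) 0 \<le> 2 / 3"
  shows "real m * (real (card {y. walk_norm \<mu> I v y \<le> 1 / (2 * real m)}) - 1)
       \<le> 4 / 3 * (\<Sum>y\<in>UNIV. walk_transform \<mu> I v y)"
proof -
  let ?f = "walk_transform \<mu> I v" and ?q = "walk_norm \<mu> I v"
  let ?B = "{y. ?q y \<le> 1 / (2 * real m)}" and ?C = "{y. ?q y \<le> 1 / 2}"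
  have C: "3 / 4 \<le> ?f y" if "y \<in> ?C" for y
  proof -
    have "(?q y)\<^sup>2 \<le> (1 / 2)\<^sup>2"
      using that by (intro power_mono) (auto simp: walk_norm_def)
    then show ?thesis using walk_transform_ge[OF \<mu>, of I v y] by (simp add: power2_eq_square)
  qed
  have "real (card ?C) * (3 / 4) \<le> sum ?f ?C"
    by (rule sum_bounded_below) (use C in auto)
  also have "\<dots> \<le> sum ?f UNIV"
    using walk_transform_nonneg[OF \<mu>] by (intro sum_mono2) auto
  finally have le: "real (card ?C) * (3 / 4) \<le> sum ?f UNIV" .
  have p: "0 < real CARD('p)" by simp
  have "sum ?f UNIV = real CARD('p) * pmf (walk_pmf \<mu> I v) 0"
    using assms by (simp add: pmf_walk_0)
  also have "\<dots> \<le> real CARD('p) * (2 / 3)" by (intro mult_left_mono spread) auto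
  finally have "real (card ?C) < real CARD('p)" using le p by linarith
  moreover have "min (CARD('p)) (m * (card ?B - 1) + 1) \<le> card ?C"
    using card_sublevel_dilate[of ?q "1 / (2 * real m)" m, OF walk_norm_0 walk_norm_add_le[OF \<mu>(1)]] \<open>m \<ge> 1\<close> by simp
  ultimately have "m * (card ?B - 1) \<le> card ?C" by (simp add: min_def split: if_splits)
  then have "real (m * (card ?B - 1)) \<le> real (card ?C)" by (rule of_nat_mono)
  moreover have "0 \<in> ?B" by simp
  then have "card ?B \<ge> 1" by (auto simp: Suc_le_eq card_gt_0_iff simp del: walk_norm_0)
  ultimately show ?thesis using le by (simp add: of_nat_diff)
qed

text \<open>
  On the level set at height \<open>1 / (2 m)\<close>, bound \<open>f ^ k\<close> by \<open>1\<close> and count; off it,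
  \<open>f ^ (k - 1) \<le> exp (- (k - 1) / (4 m\<^sup>2)) \<le> 1 / m\<close>, because \<open>m ^ 5 \<le> k\<close> and
  \<open>m \<ge> 3\<close> make \<open>(k - 1) / (4 m\<^sup>2)\<close> at least \<open>m\<close>.
\<close>

lemma sum_transform_power_le:
  fixes v :: "nat \<Rightarrow> 'p::prime_card mod_ring"
  assumes \<mu>: "0 \<le> \<mu>" "\<mu> \<le> 1 / 4" and "finite I"
    and m: "m \<ge> 3" "m ^ 5 \<le> k"
    and spread: "pmf (walk_pmf \<mu> I v) 0 \<le> 2 / 3"
  shows "(\<Sum>y\<in>UNIV. walk_transform \<mu> I v y ^ k)
       \<le> 1 + 7 / (3 * real m) * (\<Sum>y\<in>UNIV. walk_transform \<mu> I v y)"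
proof -
  let ?f = "walk_transform \<mu> I v" and ?q = "walk_norm \<mu> I v"
  let ?B = "{y. ?q y \<le> 1 / (2 * real m)}"
  have f: "0 \<le> ?f y" "?f y \<le> 1" for y
    using \<mu> walk_transform_nonneg walk_transform_le_1 by auto
  have size: "4 * m ^ 3 + 1 \<le> k"
  proof -
    have "3 * 3 * m ^ 3 \<le> m * m * m ^ 3" using m by (intro mult_mono) auto
    also have "\<dots> = m ^ 5" by (simp add: eval_nat_numeral)
    finally have "9 * m ^ 3 \<le> k" using m by simp
    moreover have "1 \<le> m ^ 3" using m by simp
    ultimately show ?thesis by linarith
  qed
  have large: "?f y ^ k \<le> 1 / real m * ?f y" if "y \<notin> ?B" for y
  proof -
    have "(1 / (2 * real m))\<^sup>2 \<le> (?q y)\<^sup>2"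
      using that by (intro power_mono) auto
    then have q: "1 / (4 * real m ^ 2) \<le> (?q y)\<^sup>2"
      by (simp add: power_divide power_mult_distrib)
    have "real m = 4 * real m ^ 3 * (1 / (4 * real m ^ 2))"
      using m by (simp add: field_simps eval_nat_numeral)
    also have "\<dots> \<le> real (k - 1) * (?q y)\<^sup>2"
    proof (rule mult_mono[OF _ q])
      have "real (4 * m ^ 3) \<le> real (k - 1)" using size by (intro of_nat_mono) auto
      then show "4 * real m ^ 3 \<le> real (k - 1)" by simp
    qed auto
    also have "\<dots> \<le> exp (real (k - 1) * (?q y)\<^sup>2)"
      using exp_ge_add_one_self[of "real (k - 1) * (?q y)\<^sup>2"] by linarith
    finally have "exp (- (real (k - 1) * (?q y)\<^sup>2)) \<le> 1 / real m"
      using m by (simp add: exp_minus field_simps)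
    moreover have "?f y ^ (k - 1) \<le> exp (- (?q y)\<^sup>2) ^ (k - 1)"
      using f walk_transform_le_exp[OF \<mu> \<open>finite I\<close>] by (intro power_mono) auto
    then have "?f y ^ (k - 1) \<le> exp (- (real (k - 1) * (?q y)\<^sup>2))"
      by (simp flip: exp_of_nat_mult)
    ultimately have "?f y ^ (k - 1) \<le> 1 / real m" by linarith
    then have "?f y ^ (k - 1) * ?f y \<le> 1 / real m * ?f y"
      using f by (intro mult_right_mono) auto
    moreover have "?f y ^ (k - 1) * ?f y = ?f y ^ k"
      using size by (metis add_leE le_add_diff_inverse2 power_add power_one_right)
    ultimately show ?thesis by simp
  qed
  have "(\<Sum>y\<in>UNIV. ?f y ^ k) \<le> (\<Sum>y\<in>UNIV. of_bool (y \<in> ?B) + 1 / real m * ?f y)"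
  proof (rule sum_mono)
    fix y
    have "0 \<le> 1 / real m * ?f y" "?f y ^ k \<le> 1" using f by (auto intro: power_le_one)
    then show "?f y ^ k \<le> of_bool (y \<in> ?B) + 1 / real m * ?f y"
      using large[of y] by (cases "y \<in> ?B") auto
  qed
  also have "\<dots> = real (card ?B) + 1 / real m * sum ?f UNIV"
    by (simp add: sum.distrib sum_distrib_left sum_divide_distrib)
  also have "real (card ?B) \<le> 1 + 4 / (3 * real m) * sum ?f UNIV"
    using card_small_norm_le[OF \<mu> \<open>finite I\<close> _ spread, of m] m by (simp add: field_simps)
  finally show ?thesis using m by (simp add: field_simps)
qed

text \<open>
  Here \<open>m\<close> is the integer part of \<open>k powr (1 / 5)\<close>. The hypothesis \<open>2 \<le> \<Sum> f ^ k\<close> absorbs the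
  additive \<open>1\<close> at the cost of a factor \<open>2\<close>. For \<open>m < 3\<close> the trivial bound \<open>f ^ k \<le> f\<close> suffices.
\<close>

lemma power_mean_bound:
  fixes v :: "nat \<Rightarrow> 'p::prime_card mod_ring"
  assumes \<mu>: "0 \<le> \<mu>" "\<mu> \<le> 1 / 4" and "finite I" and "k \<ge> 1"
    and spread: "pmf (walk_pmf \<mu> I v) 0 \<le> 2 / 3"
    and two: "2 \<le> (\<Sum>y\<in>UNIV. walk_transform \<mu> I v y ^ k)"
  shows "(\<Sum>y\<in>UNIV. walk_transform \<mu> I v y ^ k)
       \<le> 7 / real k powr (1 / 5) * (\<Sum>y\<in>UNIV. walk_transform \<mu> I v y)"
proof -
  let ?f = "walk_transform \<mu> I v"
  define R where "R = real k powr (1 / 5)"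
  define m where "m = nat \<lfloor>R\<rfloor>"
  have R: "R ^ 5 = real k" "R \<ge> 1"
    using \<open>k \<ge> 1\<close> by (simp_all add: R_def powr_powr ge_one_powr_ge_zero flip: powr_numeral)
  have mR: "real m \<le> R" "R \<le> real m + 1" using R by (auto simp: m_def)
  have nonneg: "0 \<le> ?f y" for y using \<mu> walk_transform_nonneg by auto
  then have S: "0 \<le> sum ?f UNIV" by (simp add: sum_nonneg)
  show ?thesis
  proof (cases "m \<ge> 3")
    case True
    have "real (m ^ 5) \<le> real k" using power_mono[OF mR(1), of 5] R by simp
    then have "m ^ 5 \<le> k" by (simp only: of_nat_le_iff)
    then have "(\<Sum>y\<in>UNIV. ?f y ^ k) \<le> 1 + 7 / (3 * real m) * sum ?f UNIV"
      using sum_transform_power_le[OF \<mu> \<open>finite I\<close> True _ spread] by simp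
    then have "(\<Sum>y\<in>UNIV. ?f y ^ k) \<le> 14 / (3 * real m) * sum ?f UNIV"
      using two by (simp add: field_simps)
    also have "\<dots> \<le> 7 / R * sum ?f UNIV"
      using mR True R by (intro mult_right_mono[OF _ S]) (simp add: field_simps)
    finally show ?thesis by (simp add: R_def)
  next
    case False
    then have "R \<le> 7" using mR by linarith
    have "(\<Sum>y\<in>UNIV. ?f y ^ k) \<le> sum ?f UNIV"
    proof (rule sum_mono)
      fix y
      show "?f y ^ k \<le> ?f y"
        using power_decreasing[OF \<open>k \<ge> 1\<close>, of "?f y"] nonneg walk_transform_le_1[OF \<mu>, of I v y] by simp
    qed
    also have "\<dots> \<le> 7 / R * sum ?f UNIV"
      using mult_right_mono[of 1 "7 / R", OF _ S] \<open>R \<le> 7\<close> R by simp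
    finally show ?thesis by (simp add: R_def)
  qed
qed

section \<open>Greedy blocks\<close>

text \<open>
  A largest set with the stated decay cannot be enlarged, and an index whose entry lies outside
  the neighbourhood would enlarge it: adding it lowers the probability of \<open>0\<close> from \<open>P\<close> to at most
  \<open>(1 - \<mu>) P + \<mu> P / 2\<close>.
\<close>

lemma greedy_block:
  fixes v :: "nat \<Rightarrow> 'p::prime_card mod_ring"
  assumes \<mu>: "0 \<le> \<mu>" "\<mu> \<le> 1 / 4" and "finite I"
  obtains T where "T \<subseteq> I" and "pmf (walk_pmf \<mu> T v) 0 \<le> (1 - \<mu> / 2) ^ card T"
    and "\<And>i. i \<in> I - T \<Longrightarrow> v i \<in> nbhd \<mu> T v"
proof -
  define F where "F = {T. T \<subseteq> I \<and> pmf (walk_pmf \<mu> T v) 0 \<le> (1 - \<mu> / 2) ^ card T}"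
  have "finite F" using \<open>finite I\<close> by (simp add: F_def)
  moreover have "{} \<in> F" by (simp add: F_def)
  ultimately obtain T where T: "T \<in> F" and max_T: "card T = Max (card ` F)"
    using Max_in[of "card ` F"] by fastforce
  have max: "card T' \<le> card T" if "T' \<in> F" for T'
    unfolding max_T using that \<open>finite F\<close> by (intro Max_ge) auto
  have "finite T" using T \<open>finite I\<close> finite_subset by (auto simp: F_def)
  have "v i \<in> nbhd \<mu> T v" if i: "i \<in> I - T" for i
  proof (rule ccontr)
    let ?P = "pmf (walk_pmf \<mu> T v)"
    assume "v i \<notin> nbhd \<mu> T v"
    then have "?P (v i) \<le> 1 / 2 * ?P 0" by (simp add: nbhd_def)
    then have "\<mu> * ?P (v i) \<le> \<mu> * (1 / 2 * ?P 0)" using \<mu> by (intro mult_left_mono) auto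
    moreover have "pmf (walk_pmf \<mu> (insert i T) v) 0 = (1 - \<mu>) * ?P 0 + \<mu> * ?P (v i)"
      using \<mu> i \<open>finite T\<close> by (subst pmf_walk_insert) (auto simp: pmf_walk_minus)
    ultimately have "pmf (walk_pmf \<mu> (insert i T) v) 0 \<le> (1 - \<mu> / 2) * ?P 0"
      by (simp add: algebra_simps)
    also have "\<dots> \<le> (1 - \<mu> / 2) * (1 - \<mu> / 2) ^ card T"
      using T \<mu> by (intro mult_left_mono) (auto simp: F_def)
    finally have "insert i T \<in> F" using T i \<open>finite T\<close> by (simp add: F_def)
    from max[OF this] show False using i \<open>finite T\<close> by simp
  qed
  then show thesis using that T by (auto simp: F_def)
qed

lemma greedy_blocks:
  fixes v :: "nat \<Rightarrow> 'p::prime_card mod_ring"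
  assumes \<mu>: "0 \<le> \<mu>" "\<mu> \<le> 1 / 4" and "finite I"
  shows "\<exists>T :: nat \<Rightarrow> nat set. disjoint_family_on T {..<k}
    \<and> (\<forall>j<k. T j \<subseteq> I \<and> pmf (walk_pmf \<mu> (T j) v) 0 \<le> (1 - \<mu> / 2) ^ card (T j)
           \<and> (\<forall>i\<in>I - (\<Union>l<k. T l). v i \<in> nbhd \<mu> (T j) v))"
proof (induction k)
  case 0
  show ?case by (simp add: disjoint_family_on_def)
next
  case (Suc k)
  then obtain T :: "nat \<Rightarrow> nat set" where T: "disjoint_family_on T {..<k}"
    "\<And>j. j < k \<Longrightarrow> T j \<subseteq> I" "\<And>j. j < k \<Longrightarrow> pmf (walk_pmf \<mu> (T j) v) 0 \<le> (1 - \<mu> / 2) ^ card (T j)"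
    "\<And>j i. j < k \<Longrightarrow> i \<in> I - (\<Union>l<k. T l) \<Longrightarrow> v i \<in> nbhd \<mu> (T j) v"
    by blast
  obtain U where U: "U \<subseteq> I - (\<Union>l<k. T l)" "pmf (walk_pmf \<mu> U v) 0 \<le> (1 - \<mu> / 2) ^ card U"
    "\<And>i. i \<in> I - (\<Union>l<k. T l) - U \<Longrightarrow> v i \<in> nbhd \<mu> U v"
    using greedy_block[OF \<mu>, of "I - (\<Union>l<k. T l)" v] \<open>finite I\<close> by blast
  let ?T = "T(k := U)"
  have union: "(\<Union>l<Suc k. ?T l) = (\<Union>l<k. T l) \<union> U"
    by (auto simp: lessThan_Suc)
  have "disjoint_family_on ?T {..<Suc k}"
    using T(1) U(1) by (fastforce simp: disjoint_family_on_def less_Suc_eq)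
  moreover have "?T j \<subseteq> I \<and> pmf (walk_pmf \<mu> (?T j) v) 0 \<le> (1 - \<mu> / 2) ^ card (?T j)
      \<and> (\<forall>i\<in>I - (\<Union>l<Suc k. ?T l). v i \<in> nbhd \<mu> (?T j) v)" if "j < Suc k" for j
    unfolding union using that T(2-4) U by (cases "j = k") auto
  ultimately show ?case by blast
qed

text \<open>
  The transform of a disjoint union is the product of the transforms, and pointwise the product
  of \<open>k\<close> numbers is at most the average of their \<open>k\<close>-th powers. So the claim holds on average
  over the blocks.
\<close>

lemma block_with_large_power_mean:
  fixes v :: "nat \<Rightarrow> 'p::prime_card mod_ring"
  assumes \<mu>: "0 \<le> \<mu>" "\<mu> \<le> 1 / 4" and "finite I" and "k \<ge> 1"
    and T: "disjoint_family_on T {..<k}" "\<And>j. j < k \<Longrightarrow> T j \<subseteq> I"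
  obtains j where "j < k"
    and "real CARD('p) * pmf (walk_pmf \<mu> I v) 0 \<le> (\<Sum>y\<in>UNIV. walk_transform \<mu> (T j) v y ^ k)"
proof -
  let ?S = "\<lambda>j. \<Sum>y\<in>UNIV. walk_transform \<mu> (T j) v y ^ k"
  let ?E = "real CARD('p) * pmf (walk_pmf \<mu> I v) 0"
  have "?E = (\<Sum>y\<in>UNIV. walk_transform \<mu> I v y)"
    using assms by (simp add: pmf_walk_0)
  also have "\<dots> \<le> (\<Sum>y\<in>UNIV. (\<Sum>j<k. walk_transform \<mu> (T j) v y ^ k) / k)"
  proof (rule sum_mono)
    fix y
    let ?f = "\<lambda>j. walk_transform \<mu> (T j) v y"
    have f: "0 \<le> ?f j" for j using \<mu> walk_transform_nonneg by auto
    have "walk_transform \<mu> I v y \<le> walk_transform \<mu> (\<Union>j<k. T j) v y"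
      using assms by (intro walk_transform_antimono) auto
    also have "\<dots> = (\<Prod>j<k. ?f j)"
      unfolding walk_transform_def using T \<open>finite I\<close>
      by (intro prod.UNION_disjoint) (auto simp: disjoint_family_on_def intro: finite_subset[OF T(2)])
    also have "\<dots> = ((\<Prod>j<k. ?f j) ^ k) powr (1 / k)"
      using \<open>k \<ge> 1\<close> f by (simp add: prod_nonneg powr_powr flip: powr_realpow')
    also have "\<dots> = (\<Prod>j<k. ?f j ^ k) powr (1 / k)" by (simp add: prod_power_distrib)
    also have "\<dots> \<le> (\<Sum>j<k. ?f j ^ k) / k"
      using arith_geom_mean[of "{..<k}" "\<lambda>j. ?f j ^ k"] \<open>k \<ge> 1\<close> f
      by (auto simp: lessThan_empty_iff sum_divide_distrib)
    finally show "walk_transform \<mu> I v y \<le> (\<Sum>j<k. ?f j ^ k) / k" .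
  qed
  also have "\<dots> = (\<Sum>j<k. ?S j) / k"
    unfolding sum_divide_distrib[symmetric] by (subst sum.swap) simp
  finally have avg: "real k * ?E \<le> (\<Sum>j<k. ?S j)" using \<open>k \<ge> 1\<close> by (simp add: field_simps)
  have "\<exists>j<k. ?E \<le> ?S j"
  proof (rule ccontr)
    assume "\<not> ?thesis"
    then have "(\<Sum>j<k. ?S j) < (\<Sum>j<k. ?E)"
      using \<open>k \<ge> 1\<close> by (intro sum_strict_mono) (auto simp: lessThan_empty_iff not_le)
    then show False using avg by simp
  qed
  then show thesis using that by blast
qed

lemma pmf_walk_0_less_1:
  fixes v :: "nat \<Rightarrow> 'p::prime_card mod_ring"
  assumes \<mu>: "0 < \<mu>" "\<mu> \<le> 1 / 4" and "finite I" and "i \<in> I" "v i \<noteq> 0"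
  shows "pmf (walk_pmf \<mu> I v) 0 < 1"
proof -
  have "pmf (walk_pmf \<mu> I v) 0 \<le> pmf (walk_pmf \<mu> {i} v) 0"
    using assms by (intro pmf_walk_0_antimono) auto
  also have "\<dots> = 1 - \<mu>"
    using assms by (subst pmf_walk_insert) (auto simp: pmf_return)
  finally show ?thesis using \<mu> by simp
qed

text \<open>
  Strictness matters: it makes the blocks together smaller than the number \<open>k d\<close> of guaranteed
  nonzero entries, which leaves a nonzero entry outside all of them.
\<close>

lemma block_size_less:
  assumes \<mu>: "0 < \<mu>" "\<mu> \<le> 1" and r: "0 < r" "r < 1" and le: "r \<le> (1 - \<mu> / 2) ^ t"
  shows "real t < 2 / \<mu> * ln (inverse r)"
proof (cases "t = 0")
  case True
  then show ?thesis using \<mu> r ln_less_zero[of r] by (simp add: ln_inverse divide_neg_pos)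
next
  case False
  have "ln r \<le> ln ((1 - \<mu> / 2) ^ t)" using r le \<mu> by (subst ln_le_cancel_iff) auto
  also have "\<dots> = real t * ln (1 - \<mu> / 2)" using \<mu> by (simp add: ln_realpow)
  also have "ln (1 - \<mu> / 2) < - (\<mu> / 2)"
  proof -
    have "ln (1 - \<mu> / 2) \<noteq> 1 - \<mu> / 2 - 1" using ln_eq_minus_one[of "1 - \<mu> / 2"] \<mu> by auto
    moreover have "ln (1 - \<mu> / 2) \<le> 1 - \<mu> / 2 - 1" using \<mu> by (intro ln_le_minus_one) auto
    ultimately show ?thesis by linarith
  qed
  then have "real t * ln (1 - \<mu> / 2) < real t * (- (\<mu> / 2))"
    using False by (intro mult_strict_left_mono) auto
  finally have "ln r < real t * (- (\<mu> / 2))" .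
  moreover have "ln (inverse r) = - ln r" using r by (simp add: ln_inverse)
  ultimately show ?thesis using \<mu> by (simp add: field_simps)
qed

section \<open>The inverse theorem\<close>

theorem theorem2:
  fixes \<mu> d :: real and k n :: nat and v :: "nat \<Rightarrow> 'p::prime_card mod_ring"
  assumes "0 < \<mu>" and "\<mu> \<le> 1 / 4"
    and "k \<ge> 1" and "n \<ge> 1"
    and nonzero: "\<exists>i\<in>{1..n}. v i \<noteq> 0"
    and d_eq: "d = 2 / \<mu> * ln (inverse (rho \<mu> {1..n} v))"
    and "real (weight {1..n} v) \<ge> real k * d"
    and "rho \<mu> {1..n} v \<ge> 2 / real CARD('p)"
  shows "\<exists>T\<subseteq>{1..n}. real (card T) \<le> d
    \<and> real (card {i \<in> {1..n}. v i \<notin> nbhd \<mu> T v}) \<le> real k * d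
    \<and> real (card (nbhd \<mu> T v)) \<le> 256 / (real k powr (1 / 5)) * (1 / rho \<mu> {1..n} v)"
proof -
  let ?I = "{1..n}"
  define r where "r = rho \<mu> ?I v"
  have \<mu>: "0 \<le> \<mu>" "\<mu> \<le> 1 / 4" using assms by auto
  have p: "0 < real CARD('p)" by simp
  have r_eq: "r = pmf (walk_pmf \<mu> ?I v) 0" using \<mu> by (simp add: r_def rho_eq_pmf_0)
  have r_ge: "2 \<le> real CARD('p) * r" using assms p by (simp add: r_def field_simps)
  then have "0 < real CARD('p) * r" by linarith
  then have "0 < r" by (rule zero_less_mult_pos[OF _ p])
  have "r < 1" using nonzero pmf_walk_0_less_1[OF assms(1,2)] by (auto simp: r_eq)

  obtain T where disj: "disjoint_family_on T {..<k}" and T: "\<And>j. j < k \<Longrightarrow> T j \<subseteq> ?I"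
    and decay: "\<And>j. j < k \<Longrightarrow> pmf (walk_pmf \<mu> (T j) v) 0 \<le> (1 - \<mu> / 2) ^ card (T j)"
    and rest: "\<And>j i. j < k \<Longrightarrow> i \<in> ?I - (\<Union>l<k. T l) \<Longrightarrow> v i \<in> nbhd \<mu> (T j) v"
    using greedy_blocks[OF \<mu>, of ?I k v] by blast
  define U where "U = (\<Union>l<k. T l)"
  have finite_T: "finite (T j)" if "j < k" for j using T[OF that] finite_subset by blast
  then have "finite U" by (auto simp: U_def)
  have small: "real (card (T j)) < d" if "j < k" for j
  proof -
    have "r \<le> pmf (walk_pmf \<mu> (T j) v) 0"
      unfolding r_eq using \<mu> T[OF that] by (intro pmf_walk_0_antimono) auto
    then have "r \<le> (1 - \<mu> / 2) ^ card (T j)" using decay[OF that] by linarith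
    then show ?thesis
      using block_size_less[of \<mu> r] \<open>0 < r\<close> \<open>r < 1\<close> assms(1,2) by (simp add: d_eq r_def)
  qed
  have "real (card U) \<le> (\<Sum>l<k. real (card (T l)))"
    using card_UN_le[of "{..<k}" T] by (simp add: U_def flip: of_nat_sum)
  also have "\<dots> < (\<Sum>l<k. d)"
    using small \<open>k \<ge> 1\<close> by (intro sum_strict_mono) (auto simp: lessThan_empty_iff)
  finally have card_U: "real (card U) < real k * d" by simp

  have "\<not> {i \<in> ?I. v i \<noteq> 0} \<subseteq> U"
  proof
    assume "{i \<in> ?I. v i \<noteq> 0} \<subseteq> U"
    then have "weight ?I v \<le> card U" unfolding weight_def using \<open>finite U\<close> by (rule card_mono[rotated])
    then show False using card_U assms by linarith
  qed
  then obtain i where i: "i \<in> ?I - U" "v i \<noteq> 0" by blast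

  obtain j where j: "j < k"
    and mean: "real CARD('p) * r \<le> (\<Sum>y\<in>UNIV. walk_transform \<mu> (T j) v y ^ k)"
    using block_with_large_power_mean[OF \<mu> _ \<open>k \<ge> 1\<close> disj T, where v = v] by (auto simp: r_eq)
  let ?s = "pmf (walk_pmf \<mu> (T j) v) 0"
  have "?s \<le> 2 / 3" using pmf_walk_0_le_of_nbhd[OF rest[OF j]] i by (auto simp: U_def)
  then have "(\<Sum>y\<in>UNIV. walk_transform \<mu> (T j) v y ^ k)
      \<le> 7 / real k powr (1 / 5) * (\<Sum>y\<in>UNIV. walk_transform \<mu> (T j) v y)"
    using mean r_ge by (intro power_mean_bound[OF \<mu> finite_T[OF j] \<open>k \<ge> 1\<close>]) auto
  then have "real CARD('p) * r \<le> 7 / real k powr (1 / 5) * (real CARD('p) * ?s)"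
    unfolding pmf_walk_0[OF \<mu> finite_T[OF j]] using mean by linarith
  then have "real CARD('p) * r \<le> real CARD('p) * (7 / real k powr (1 / 5) * ?s)"
    by (simp only: mult.left_commute)
  then have r_le: "r \<le> 7 / real k powr (1 / 5) * ?s"
    by (simp only: mult_le_cancel_left_pos[OF p])
  have "real (card (nbhd \<mu> (T j) v)) * r
      \<le> real (card (nbhd \<mu> (T j) v)) * (7 / real k powr (1 / 5) * ?s)"
    by (intro mult_left_mono r_le) auto
  also have "\<dots> = 7 / real k powr (1 / 5) * (real (card (nbhd \<mu> (T j) v)) * ?s)" by simp
  also have "\<dots> \<le> 7 / real k powr (1 / 5) * 2"
    by (intro mult_left_mono card_nbhd_le) auto
  also have "\<dots> \<le> 256 / real k powr (1 / 5)" by (simp add: divide_right_mono)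
  finally have "real (card (nbhd \<mu> (T j) v)) \<le> 256 / real k powr (1 / 5) / r"
    using \<open>0 < r\<close> by (simp only: pos_le_divide_eq)
  then have nbhd: "real (card (nbhd \<mu> (T j) v)) \<le> 256 / real k powr (1 / 5) * (1 / r)"
    by simp
  have "{i \<in> ?I. v i \<notin> nbhd \<mu> (T j) v} \<subseteq> U" using rest[OF j] by (auto simp: U_def)
  then have "card {i \<in> ?I. v i \<notin> nbhd \<mu> (T j) v} \<le> card U" using \<open>finite U\<close> by (rule card_mono[rotated])
  then have "real (card {i \<in> ?I. v i \<notin> nbhd \<mu> (T j) v}) \<le> real k * d" using card_U by linarith
  then show ?thesis using T[OF j] small[OF j] nbhd by (intro exI[of _ "T j"]) (auto simp: r_def)
qed

end
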